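(* Let $m$ and $q$ be positive integers. For $1 \leq i \leq m$ let $\mathcal{H}_i = (V_i, E_i)$ be a hypergraph, where the vertex sets $V_1, \ldots, V_m$ are pairwise disjoint. Let $\mathcal{H} = (V, E)$ be the hypergraph with $V = \bigcup_{i=1}^m V_i$ and $E = \{\bigcup_{i=1}^m e_i : e_i \in E_i \text{ for all } i\}$. Let $Q = q\left(1 + \log\left(m + \left\lceil \frac{\sum_{i=1}^m |V_i|}{q+1} \right\rceil\right)\right)$. If, for every $1 \leq i \leq m$, Maker has a strategy to win the $(1 : Q)$ Maker-Breaker game on $\mathcal{H}_i$ within $t_i$ moves, then Maker has a strategy to win the $(1 : q)$ Maker-Breaker game on $\mathcal{H}$ within $\sum_{i=1}^m t_i$ moves.
   Context: A Maker-Breaker game on a hypergraph $\mathcal{H}=(V,E)$ with bias $(1:q)$: the board is the vertex set $V$ and the winning sets are the hyperedges in $E$. Maker and Breaker alternately claim previously unclaimed vertices of the board, Breaker going first; Maker claims $1$ vertex per turn and Breaker claims $q$ (or all remaining ones if fewer remain). Maker wins as soon as he has claimed all vertices of some hyperedge; otherwise Breaker wins. $\log$ denotes the natural logarithm. *)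

theory Defs
  imports Complex_Main "HOL-Library.Disjoint_Sets"
begin

definition hypergraph :: "'a set \<Rightarrow> 'a set set \<Rightarrow> bool" where
  "hypergraph V E \<longleftrightarrow> finite V \<and> (\<forall>e\<in>E. e \<subseteq> V)"

text \<open>A history is the list of completed rounds, oldest first. A round consists of the set of
  vertices claimed by Breaker, who goes first, and the vertex with which Maker answers.\<close>

type_synonym 'a history = "('a set \<times> 'a) list"

definition maker_claimed :: "'a history \<Rightarrow> 'a set" where
  "maker_claimed h = snd ` set h"

definition breaker_claimed :: "'a history \<Rightarrow> 'a set" where
  "breaker_claimed h = \<Union> (fst ` set h)"

definition unclaimed :: "'a set \<Rightarrow> 'a history \<Rightarrow> 'a set" where
  "unclaimed V h = V - (maker_claimed h \<union> breaker_claimed h)"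

definition maker_won :: "'a set set \<Rightarrow> 'a history \<Rightarrow> bool" where
  "maker_won E h \<longleftrightarrow> (\<exists>e\<in>E. e \<subseteq> maker_claimed h)"

definition breaker_move :: "nat \<Rightarrow> 'a set \<Rightarrow> 'a history \<Rightarrow> 'a set \<Rightarrow> bool" where
  "breaker_move q V h B \<longleftrightarrow> B \<subseteq> unclaimed V h \<and> card B = min q (card (unclaimed V h))"

definition maker_move :: "'a set \<Rightarrow> 'a history \<Rightarrow> 'a set \<Rightarrow> 'a \<Rightarrow> bool" where
  "maker_move V h B v \<longleftrightarrow> v \<in> unclaimed V h - B"

text \<open>A Maker strategy sees the completed rounds and Breaker's move in the current one.\<close>

type_synonym 'a strategy = "'a history \<Rightarrow> 'a set \<Rightarrow> 'a"

text \<open>The histories that can arise in the \<open>(1 : q)\<close> game when Maker follows \<open>\<sigma>\<close>.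
  Play stops as soon as Maker has won.\<close>

inductive play :: "nat \<Rightarrow> 'a set \<Rightarrow> 'a set set \<Rightarrow> 'a strategy \<Rightarrow> 'a history \<Rightarrow> bool"
  for q :: nat and V :: "'a set" and E :: "'a set set" and \<sigma> :: "'a strategy" where
  start: "play q V E \<sigma> []"
| round: "play q V E \<sigma> h \<Longrightarrow> \<not> maker_won E h \<Longrightarrow> breaker_move q V h B \<Longrightarrow>
    maker_move V h B (\<sigma> h B) \<Longrightarrow> play q V E \<sigma> (h @ [(B, \<sigma> h B)])"

text \<open>As long as Maker has not won, he has made fewer than \<open>t\<close> moves and \<open>\<sigma>\<close> supplies a
  legal answer to every Breaker move. In particular Breaker cannot exhaust the board first:
  then no legal answer would exist. On a finite board Breaker always has a legal move (the empty
  one if nothing is left), so no play gets stuck on Breaker's turn.\<close>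

definition wins_within :: "nat \<Rightarrow> 'a set \<Rightarrow> 'a set set \<Rightarrow> nat \<Rightarrow> 'a strategy \<Rightarrow> bool" where
  "wins_within q V E t \<sigma> \<longleftrightarrow>
    (\<forall>h. play q V E \<sigma> h \<and> \<not> maker_won E h \<longrightarrow>
      length h < t \<and> (\<forall>B. breaker_move q V h B \<longrightarrow> maker_move V h B (\<sigma> h B)))"

definition maker_can_win_within :: "nat \<Rightarrow> 'a set \<Rightarrow> 'a set set \<Rightarrow> nat \<Rightarrow> bool" where
  "maker_can_win_within q V E t \<longleftrightarrow> (\<exists>\<sigma>. wins_within q V E t \<sigma>)"

definition join_vertices :: "nat \<Rightarrow> (nat \<Rightarrow> 'a set) \<Rightarrow> 'a set" where
  "join_vertices m V = (\<Union>i\<in>{1..m}. V i)"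

definition join_edges :: "nat \<Rightarrow> (nat \<Rightarrow> 'a set set) \<Rightarrow> 'a set set" where
  "join_edges m E = {(\<Union>i\<in>{1..m}. e i) | e. \<forall>i\<in>{1..m}. e i \<in> E i}"

end

theory Submission
  imports Defs "HOL-Analysis.Harmonic_Numbers"
begin

text \<open>Maker simulates one game per board. On each board where he has not yet won he keeps track of
  the unclaimed vertices of the simulated game that Breaker really owns, and he always answers on
  the board with the most such vertices, padding them arbitrarily to a legal Breaker move of the
  simulated game. This is a box game in which Breaker adds \<open>q\<close> tokens per round and Maker then
  empties a fullest box. In the \<open>n\<close>-th round no box exceeds \<open>q\<close> times the \<open>n\<close>-th harmonic number,
  and every round but the last uses up \<open>q + 1\<close> vertices.\<close>

section \<open>Plays and strategies\<close>

lemma unclaimed_Nil [simp]: "unclaimed V [] = V"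
  by (simp add: unclaimed_def maker_claimed_def breaker_claimed_def)

lemma maker_claimed_Nil [simp]: "maker_claimed [] = {}"
  by (simp add: maker_claimed_def)

lemma breaker_claimed_Nil [simp]: "breaker_claimed [] = {}"
  by (simp add: breaker_claimed_def)

lemma maker_claimed_snoc [simp]: "maker_claimed (h @ [(B, v)]) = insert v (maker_claimed h)"
  by (auto simp: maker_claimed_def)

lemma breaker_claimed_snoc [simp]: "breaker_claimed (h @ [(B, v)]) = breaker_claimed h \<union> B"
  by (auto simp: breaker_claimed_def)

lemma unclaimed_snoc [simp]: "unclaimed V (h @ [(B, v)]) = unclaimed V h - insert v B"
  by (auto simp: unclaimed_def)

lemma finite_unclaimed: "finite V \<Longrightarrow> finite (unclaimed V h)"
  by (simp add: unclaimed_def)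

lemma maker_won_snoc: "maker_won E h \<Longrightarrow> maker_won E (h @ [(B, v)])"
  by (auto simp: maker_won_def)

text \<open>A legal answer lies outside \<open>B\<close>, so Breaker did not take all that was left
  and his move has full size \<open>q\<close>. Hence the count is exact.\<close>

lemma card_unclaimed_snoc:
  assumes "finite V" "breaker_move q V h B" "maker_move V h B v"
  shows "card (unclaimed V (h @ [(B, v)])) + Suc q = card (unclaimed V h)"
proof -
  let ?U = "unclaimed V h"
  have fin: "finite ?U" using assms(1) by (rule finite_unclaimed)
  have B: "B \<subseteq> ?U" and cB: "card B = min q (card ?U)" and v: "v \<in> ?U" "v \<notin> B"
    using assms(2,3) by (auto simp: breaker_move_def maker_move_def)
  have "card B < card ?U" using B v fin by (intro psubset_card_mono) auto
  with cB have q: "card B = q" by simp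
  have finB: "finite B" using B fin finite_subset by blast
  have sub: "insert v B \<subseteq> ?U" using B v by auto
  have "card (?U - insert v B) = card ?U - Suc q"
    using card_Diff_subset[OF _ sub] finB v q by simp
  moreover have "Suc q \<le> card ?U" using \<open>card B < card ?U\<close> q by simp
  ultimately show ?thesis by simp
qed

text \<open>Maker needs no memory beyond the real history: \<open>Inv\<close> may hide the simulated
  games behind an existential quantifier, and a choice depending on \<open>h\<close> and
  \<open>B\<close> alone keeps it alive.\<close>

lemma maker_can_win_within_invariant:
  assumes start: "Inv []"
    and len: "\<And>h. Inv h \<Longrightarrow> \<not> maker_won E h \<Longrightarrow> length h < t"
    and step: "\<And>h B. Inv h \<Longrightarrow> \<not> maker_won E h \<Longrightarrow> breaker_move q V h B \<Longrightarrow>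
      \<exists>v. maker_move V h B v \<and> Inv (h @ [(B, v)])"
  shows "maker_can_win_within q V E t"
proof -
  define \<sigma> where "\<sigma> h B = (SOME v. maker_move V h B v \<and> Inv (h @ [(B, v)]))" for h B
  have \<sigma>: "maker_move V h B (\<sigma> h B) \<and> Inv (h @ [(B, \<sigma> h B)])"
    if "Inv h" "\<not> maker_won E h" "breaker_move q V h B" for h B
    unfolding \<sigma>_def by (rule someI_ex) (rule step[OF that])
  have "Inv h" if "play q V E \<sigma> h" for h
    using that by induction (use start \<sigma> in auto)
  then have "wins_within q V E t \<sigma>"
    unfolding wins_within_def using len \<sigma> by blast
  then show ?thesis unfolding maker_can_win_within_def by blast
qed

text \<open>Play stops at a win, so the last round began in a position not yet won, where fewer than
  \<open>t\<close> rounds had been played.\<close>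

lemma length_le_if_wins_within:
  assumes "wins_within q V E t \<sigma>" "play q V E \<sigma> h"
  shows "length h \<le> t"
  using assms(2)
proof cases
  case (round h' B)
  then have "length h' < t" using assms(1) by (auto simp: wins_within_def)
  with round show ?thesis by simp
qed simp

section \<open>The box game\<close>

text \<open>The bound on a single box in the next round comes from \<open>K = 1\<close>; sets of \<open>K\<close> boxes are needed
  because Maker, emptying a fullest box, only controls averages.\<close>

definition boxes_bounded :: "nat \<Rightarrow> nat \<Rightarrow> 'i set \<Rightarrow> ('i \<Rightarrow> nat) \<Rightarrow> bool" where
  "boxes_bounded q r A b \<longleftrightarrow> (\<forall>S K. S \<subseteq> A \<longrightarrow> card S \<le> K \<longrightarrow>
     real (sum b S) \<le> real K * real q * (harm (r + K) - harm K))"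

text \<open>One round takes \<open>b\<close> to \<open>b'\<close> by Breaker's tokens and to
  \<open>b''\<close> by emptying \<open>a\<close>; \<open>A'\<close> allows boxes to drop out. Among
  \<open>K + 1\<close> boxes including \<open>a\<close>, the fullest holds at least the average, so
  the others keep at most the fraction K/(K+1) of the tokens.\<close>

lemma boxes_bounded_step:
  assumes bnd: "boxes_bounded q r A b" and fin: "finite A"
    and breaker: "\<And>S. S \<subseteq> A \<Longrightarrow> sum b' S \<le> sum b S + q"
    and a: "a \<in> A" and max: "\<And>i. i \<in> A \<Longrightarrow> b' i \<le> b' a"
    and sub: "A' \<subseteq> A" and b'': "b'' a = 0" "\<And>i. i \<in> A - {a} \<Longrightarrow> b'' i = b' i"
  shows "real (b' a) \<le> real q * harm (Suc r)"
    and "boxes_bounded q (Suc r) A' b''"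
proof -
  have before: "real (sum b' S) \<le> real (Suc K) * real q * (harm (Suc r + K) - harm K)"
    if "S \<subseteq> A" "card S \<le> Suc K" for S K
  proof -
    have "real (sum b' S) \<le> real (sum b S) + real q"
      using breaker[OF that(1)] by (metis of_nat_add of_nat_mono)
    also have "\<dots> \<le> real (Suc K) * real q * (harm (r + Suc K) - harm (Suc K)) + real q"
      using bnd[unfolded boxes_bounded_def, rule_format, OF that] by simp
    \<comment> \<open>The added \<open>q\<close> is absorbed because
      \<open>harm (Suc K) - harm K\<close> is 1/(K+1).\<close>
    also have "\<dots> = real (Suc K) * real q * (harm (Suc r + K) - harm K)"
      by (simp add: harm_Suc[of K] field_simps del: of_nat_Suc)
    finally show ?thesis .
  qed
  show "real (b' a) \<le> real q * harm (Suc r)"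
    using before[of "{a}" 0] a by (simp add: harm_expand)
  show "boxes_bounded q (Suc r) A' b''"
    unfolding boxes_bounded_def
  proof (intro allI impI)
    fix S K assume S: "S \<subseteq> A'" "card S \<le> K"
    \<comment> \<open>Whether or not \<open>a\<close> is in \<open>S\<close>, at most
      \<open>K\<close> boxes remain in \<open>T\<close>, and adding \<open>a\<close> gives at most
      \<open>K + 1\<close>.\<close>
    define T where "T = S - {a}"
    let ?D = "real q * (harm (Suc r + K) - harm K)"
    have "finite S" using S sub fin by (meson finite_subset)
    then have finT: "finite T" and aT: "a \<notin> T" by (auto simp: T_def)
    have sub': "T \<subseteq> A" using S sub by (auto simp: T_def)
    have card: "card T \<le> K" unfolding T_def using S(2) by (meson card_Diff1_le le_trans)
    have "sum b'' S = sum b'' T"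
      unfolding T_def using \<open>finite S\<close> b''(1) by (intro sum.mono_neutral_right) auto
    also have "\<dots> = sum b' T" using sub' aT b''(2) by (intro sum.cong) auto
    finally have eq: "sum b'' S = sum b' T" .
    have "card (insert a T) \<le> Suc K"
      using card finT aT by simp
    then have "real (sum b' (insert a T)) \<le> real (Suc K) * real q * (harm (Suc r + K) - harm K)"
      using sub' a by (intro before) auto
    then have tot: "real (sum b' T) + real (b' a) \<le> real (Suc K) * ?D"
      using finT aT by (simp add: mult.assoc add.commute)
    have "sum b' T \<le> card T * b' a"
      using sum_bounded_above[of T b' "b' a"] max sub' by auto
    also have "\<dots> \<le> K * b' a" using card by simp
    finally have avg: "real (sum b' T) \<le> real K * real (b' a)"
      by (metis of_nat_mono of_nat_mult)
    have "real K * (real (sum b' T) + real (b' a)) \<le> real K * (real (Suc K) * ?D)"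
      using tot by (intro mult_left_mono) auto
    with avg have "real (Suc K) * real (sum b' T) \<le> real (Suc K) * (real K * ?D)"
      by (simp add: algebra_simps)
    then have "real (sum b' T) \<le> real K * ?D"
      by (rule mult_left_le_imp_le) simp
    then show "real (sum b'' S) \<le> real K * real q * (harm (Suc r + K) - harm K)"
      by (simp add: eq mult.assoc)
  qed
qed

text \<open>\<open>harm n - ln n\<close> decreases in \<open>n\<close> and equals 1 at
  \<open>n = 1\<close>.\<close>

lemma harm_le_ln_add_one:
  assumes "n > 0"
  shows "harm n \<le> 1 + ln (real n)"
  using euler_mascheroni_sequence_decreasing[of 1 n] assms by (simp add: harm_expand)

section \<open>The simulation\<close>

theorem theorem2p5:
  fixes m q :: nat
    and V :: "nat \<Rightarrow> 'a set"
    and E :: "nat \<Rightarrow> 'a set set"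
    and t :: "nat \<Rightarrow> nat"
    and Q :: real
  assumes "m \<ge> 1" and "q \<ge> 1"
    and "\<And>i. i \<in> {1..m} \<Longrightarrow> hypergraph (V i) (E i)"
    and "disjoint_family_on V {1..m}"
    and "Q = real q * (1 + ln (real m +
               real_of_int \<lceil>real (\<Sum>i=1..m. card (V i)) / real (q + 1)\<rceil>))"
    and "\<And>i. i \<in> {1..m} \<Longrightarrow> maker_can_win_within (nat \<lfloor>Q\<rfloor>) (V i) (E i) (t i)"
  shows "maker_can_win_within q (join_vertices m V) (join_edges m E) (\<Sum>i=1..m. t i)"
proof -
  let ?V = "join_vertices m V" and ?E = "join_edges m E"
  define N where "N = nat \<lfloor>Q\<rfloor>"
  have "\<forall>i. \<exists>\<sigma>. i \<in> {1..m} \<longrightarrow> wins_within N (V i) (E i) (t i) \<sigma>"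
    using assms(6) unfolding maker_can_win_within_def N_def by blast
  then obtain \<sigma> where \<sigma>: "\<And>i. i \<in> {1..m} \<Longrightarrow> wins_within N (V i) (E i) (t i) (\<sigma> i)"
    by metis
  have finV: "finite (V i)" if "i \<in> {1..m}" for i
    using assms(3)[OF that] by (simp add: hypergraph_def)
  have disj: "V i \<inter> V j = {}" if "i \<in> {1..m}" "j \<in> {1..m}" "i \<noteq> j" for i j
    using assms(4) that by (auto simp: disjoint_family_on_def)
  have fin: "finite ?V" using finV by (simp add: join_vertices_def)
  have cardV: "card ?V = (\<Sum>i=1..m. card (V i))"
    unfolding join_vertices_def using finV disj by (intro card_UN_disjoint) auto

  define active where "active g = {i \<in> {1..m}. \<not> maker_won (E i) (g i)}"
    for g :: "nat \<Rightarrow> 'a history"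
  define unanswered where "unanswered X g i = X \<inter> unclaimed (V i) (g i)"
    for X and g :: "nat \<Rightarrow> 'a history" and i
  \<comment> \<open>Only Maker's claims agree in the real and simulated games. Padding may give the
    simulated Breaker vertices that are free in reality; should they be claimed later, they do not
    count as unanswered. The equation on unclaimed vertices bounds the number of rounds.\<close>
  define simulated_by where "simulated_by h g \<longleftrightarrow>
      (\<forall>i\<in>{1..m}. play N (V i) (E i) (\<sigma> i) (g i) \<and> maker_claimed h \<inter> V i = maker_claimed (g i)) \<and>
      length h = (\<Sum>i=1..m. length (g i)) \<and>
      card (unclaimed ?V h) + Suc q * length h = card ?V \<and>
      boxes_bounded q (length h) (active g) (\<lambda>i. card (unanswered (breaker_claimed h) g i))"
    for h g

  have round_bound: "real q * harm (Suc r) \<le> Q" if "Suc q * r \<le> card ?V" for r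
  proof -
    let ?x = "real (card ?V) / real (q + 1)"
    have "real (Suc q) * real r \<le> real (card ?V)"
      using that by (metis of_nat_mono of_nat_mult)
    then have "real r \<le> ?x" by (simp add: field_simps)
    also have "?x \<le> real_of_int \<lceil>?x\<rceil>" by (rule le_of_int_ceiling)
    \<comment> \<open>The round after \<open>r\<close> completed ones costs an extra 1, paid for by
      \<open>m \<ge> 1\<close>.\<close>
    finally have "real (Suc r) \<le> real m + real_of_int \<lceil>?x\<rceil>" using assms(1) by simp
    then have "ln (real (Suc r)) \<le> ln (real m + real_of_int \<lceil>?x\<rceil>)"
      by (intro ln_mono) auto
    then have "harm (Suc r) \<le> 1 + ln (real m + real_of_int \<lceil>?x\<rceil>)"
      using harm_le_ln_add_one[of "Suc r"] by simp
    then show ?thesis unfolding assms(5) cardV by (intro mult_left_mono) auto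
  qed

  have some_active: "active g \<noteq> {}" if "simulated_by h g" "\<not> maker_won ?E h" for h g
  proof
    assume "active g = {}"
    then have "\<forall>i\<in>{1..m}. \<exists>e. e \<in> E i \<and> e \<subseteq> maker_claimed (g i)"
      by (auto simp: active_def maker_won_def)
    then obtain e where e: "\<And>i. i \<in> {1..m} \<Longrightarrow> e i \<in> E i \<and> e i \<subseteq> maker_claimed (g i)"
      by metis
    have "(\<Union>i\<in>{1..m}. e i) \<in> ?E" unfolding join_edges_def using e by blast
    moreover have "(\<Union>i\<in>{1..m}. e i) \<subseteq> maker_claimed h"
      using e that(1) unfolding simulated_by_def by blast
    ultimately show False using that(2) unfolding maker_won_def by blast
  qed

  have "simulated_by [] (\<lambda>_. [])"
    by (auto simp: simulated_by_def boxes_bounded_def unanswered_def intro: play.start)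
  moreover have "length h < (\<Sum>i=1..m. t i)"
    if sim: "simulated_by h g" and nw: "\<not> maker_won ?E h" for h g
  proof -
    have "length (g i) \<le> t i" if "i \<in> {1..m}" for i
      using length_le_if_wins_within[OF \<sigma>[OF that]] sim that by (auto simp: simulated_by_def)
    \<comment> \<open>A board not yet won makes one summand strictly smaller.\<close>
    moreover obtain i where "i \<in> active g" using some_active[OF sim nw] by blast
    then have "i \<in> {1..m}" "length (g i) < t i"
      using \<sigma>[of i] sim by (auto simp: active_def wins_within_def simulated_by_def)
    ultimately have "(\<Sum>i=1..m. length (g i)) < (\<Sum>i=1..m. t i)"
      by (intro sum_strict_mono_ex1) auto
    then show ?thesis using sim by (simp add: simulated_by_def)
  qed
  moreover have "\<exists>v. maker_move ?V h B v \<and> (\<exists>g. simulated_by (h @ [(B, v)]) g)"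
    if sim: "simulated_by h g" and nw: "\<not> maker_won ?E h" and B: "breaker_move q ?V h B"
    for h B g
  proof -
    let ?X = "breaker_claimed h \<union> B"
    let ?b = "\<lambda>i. card (unanswered (breaker_claimed h) g i)"
    let ?b' = "\<lambda>i. card (unanswered ?X g i)"
    have g: "play N (V i) (E i) (\<sigma> i) (g i)" "maker_claimed h \<inter> V i = maker_claimed (g i)"
      if "i \<in> {1..m}" for i using sim that by (auto simp: simulated_by_def)
    have finU: "finite (unanswered Y g i)" if "i \<in> {1..m}" for Y i
      unfolding unanswered_def using finite_unclaimed[OF finV[OF that]] by simp
    have act: "active g \<subseteq> {1..m}" and fin_act: "finite (active g)" by (auto simp: active_def)
    have bnd: "boxes_bounded q (length h) (active g) ?b" using sim unfolding simulated_by_def by blast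
    have finB: "finite B" and cardB: "card B \<le> q"
      using B fin finite_unclaimed[OF fin] by (auto simp: breaker_move_def intro: finite_subset)
    have breaker: "sum ?b' S \<le> sum ?b S + q" if "S \<subseteq> active g" for S
    proof -
      have S: "S \<subseteq> {1..m}" "finite S" using that act fin_act finite_subset by auto
      have "sum ?b' S \<le> (\<Sum>i\<in>S. ?b i + card (B \<inter> V i))"
      proof (rule sum_mono)
        fix i assume "i \<in> S"
        then have i: "i \<in> {1..m}" using S by blast
        have "?b' i \<le> card (unanswered (breaker_claimed h) g i \<union> (B \<inter> V i))"
          using finU[OF i] finB by (intro card_mono) (auto simp: unanswered_def unclaimed_def)
        also have "\<dots> \<le> ?b i + card (B \<inter> V i)" by (rule card_Un_le)
        finally show "?b' i \<le> ?b i + card (B \<inter> V i)" .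
      qed
      also have "\<dots> = sum ?b S + (\<Sum>i\<in>S. card (B \<inter> V i))" by (rule sum.distrib)
      \<comment> \<open>The boards are disjoint, so each vertex of \<open>B\<close> puts a token
        into at most one box.\<close>
      also have "(\<Sum>i\<in>S. card (B \<inter> V i)) = card (\<Union>i\<in>S. B \<inter> V i)"
      proof (rule card_UN_disjoint[symmetric])
        show "\<forall>i\<in>S. \<forall>j\<in>S. i \<noteq> j \<longrightarrow> (B \<inter> V i) \<inter> (B \<inter> V j) = {}"
          using disj S by blast
      qed (use S finB in auto)
      also have "\<dots> \<le> card B" using finB by (intro card_mono) auto
      finally show ?thesis using cardB by simp
    qed
    have "Max (?b' ` active g) \<in> ?b' ` active g"
      using some_active[OF sim nw] fin_act by (intro Max_in) auto
    then obtain a where a: "a \<in> active g" and eq: "Max (?b' ` active g) = ?b' a" by blast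
    have max: "?b' i \<le> ?b' a" if "i \<in> active g" for i
      using that fin_act eq by (metis Max_ge finite_imageI imageI)
    have am: "a \<in> {1..m}" and a_nw: "\<not> maker_won (E a) (g a)" using a by (auto simp: active_def)

    \<comment> \<open>Only the bound before Maker's answer is wanted, so \<open>b''\<close> is a
      dummy: box \<open>a\<close> set to 0, all boards kept.\<close>
    have "real (?b' a) \<le> real q * harm (Suc (length h))"
      by (rule boxes_bounded_step(1)[OF bnd fin_act breaker a max order_refl,
            where b'' = "?b'(a := 0)"]) auto
    also have "\<dots> \<le> Q" using sim unfolding simulated_by_def by (intro round_bound) linarith
    finally have "?b' a \<le> N" unfolding N_def by linarith
    then have "?b' a \<le> min N (card (unclaimed (V a) (g a)))"
      using finite_unclaimed[OF finV[OF am]] by (auto simp: unanswered_def intro: card_mono)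
    \<comment> \<open>\<open>C\<close> is the padded move: it answers for all of Breaker's
      outstanding vertices on board \<open>a\<close> and has the exact size that the simulated game
      demands.\<close>
    then obtain C where C: "unanswered ?X g a \<subseteq> C" "C \<subseteq> unclaimed (V a) (g a)"
        "card C = min N (card (unclaimed (V a) (g a)))"
      using exists_subset_between[OF _ min.cobounded2 _ finite_unclaimed[OF finV[OF am]]]
      by (metis unanswered_def inf_le2)
    have Cmove: "breaker_move N (V a) (g a) C" using C by (simp add: breaker_move_def)
    define v where "v = \<sigma> a (g a) C"
    define g' where "g' = g(a := g a @ [(C, v)])"
    have vmove: "maker_move (V a) (g a) C v"
      using \<sigma>[OF am] g(1)[OF am] a_nw Cmove unfolding wins_within_def v_def by blast
    then have v: "v \<in> V a" "v \<in> unclaimed (V a) (g a)" "v \<notin> C"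
      by (auto simp: maker_move_def unclaimed_def)
    \<comment> \<open>If Breaker really owned \<open>v\<close>, it would be unanswered and hence in
      \<open>C\<close>, which the simulated answer avoids.\<close>
    have "v \<notin> ?X" using v C(1) by (auto simp: unanswered_def)
    moreover have "v \<notin> maker_claimed h" using v g(2)[OF am] by (auto simp: unclaimed_def)
    moreover have "v \<in> ?V" using v am by (auto simp: join_vertices_def)
    ultimately have move: "maker_move ?V h B v" by (simp add: maker_move_def unclaimed_def)

    have "play N (V i) (E i) (\<sigma> i) (g' i)" if "i \<in> {1..m}" for i
      using g(1)[OF that] g(1)[OF am] play.round[OF g(1)[OF am] a_nw Cmove] vmove
      by (auto simp: g'_def v_def)
    moreover have "maker_claimed (h @ [(B, v)]) \<inter> V i = maker_claimed (g' i)" if "i \<in> {1..m}" for i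
      using g(2)[OF that] v(1) disj[OF that am] by (auto simp: g'_def)
    moreover have "length (h @ [(B, v)]) = (\<Sum>i=1..m. length (g' i))"
    proof -
      have "(\<Sum>i=1..m. length (g' i)) = (\<Sum>i=1..m. length (g i) + (if i = a then 1 else 0))"
        by (intro sum.cong) (auto simp: g'_def)
      also have "\<dots> = Suc (length h)"
        using sim am by (simp add: sum.distrib simulated_by_def)
      finally show ?thesis by simp
    qed
    moreover have "card (unclaimed ?V (h @ [(B, v)])) + Suc q * length (h @ [(B, v)]) = card ?V"
    proof -
      have "card (unclaimed ?V h) + Suc q * length h = card ?V"
        using sim unfolding simulated_by_def by blast
      then show ?thesis using card_unclaimed_snoc[OF fin B move] by simp
    qed
    moreover have "boxes_bounded q (length (h @ [(B, v)])) (active g')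
        (\<lambda>i. card (unanswered (breaker_claimed (h @ [(B, v)])) g' i))"
    proof -
      have "active g' \<subseteq> active g"
        by (auto simp: active_def g'_def maker_won_snoc split: if_splits)
      \<comment> \<open>The simulated Breaker now owns \<open>C\<close>, so box \<open>a\<close> is
        empty.\<close>
      moreover have "unanswered ?X g' a = {}"
        using C(1) by (auto simp: unanswered_def g'_def)
      moreover have "unanswered ?X g' i = unanswered ?X g i" if "i \<in> active g - {a}" for i
        using that by (simp add: unanswered_def g'_def)
      ultimately show ?thesis
        using boxes_bounded_step(2)[OF bnd fin_act breaker a max,
            where b'' = "\<lambda>i. card (unanswered ?X g' i)"] by simp
    qed
    ultimately have "simulated_by (h @ [(B, v)]) g'" unfolding simulated_by_def by blast
    with move show ?thesis by blast
  qed
  ultimately show ?thesis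
    by (intro maker_can_win_within_invariant[where Inv = "\<lambda>h. \<exists>g. simulated_by h g"]) blast+
qed

end
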